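(* Let $0\le\lambda<1/24$. Then there is a $\mathsf{NISQ}_\lambda$ algorithm which can solve the Bernstein–Vazirani problem on $n$ bits with probability at least $1-\delta$ using $\mathcal{O}\!\left(\frac{1}{1-24\lambda}\log(n/\delta)\right)$ queries.
   Context: **Bernstein–Vazirani problem.** There is an unknown hidden string $s\in\{0,1\}^n$ and a function $f:\{0,1\}^n\to\{0,1\}$, $f(x)=s\cdot x \pmod 2$. Given oracle access to $f$, the goal is to output $s$. The quantum oracle is the unitary $O_f:|x\rangle\otimes|y\rangle\mapsto|x\rangle\otimes|y\oplus f(x)\rangle$ with $x\in\{0,1\}^n$, $y\in\{0,1\}$. **Noisy circuits.** $D_\lambda[\rho]=(1-\lambda)\rho+\lambda I/2$ is the single-qubit depolarizing channel. A depth-1 unitary is a tensor product of two-qubit unitaries. A $\lambda$-noisy quantum circuit with oracle access on $n'$ qubits is given by unitaries $U_1,\dots,U_T$, each either depth-1 or $O_f\otimes I$; running it returns a random string $z\in\{0,1\}^{n'}$ with probability $$p(z)=\langle z| D_\lambda^{\otimes n'}[U_T\cdots D_\lambda^{\otimes n'}[U_1 D_\lambda^{\otimes n'}[|0^{n'}\rangle\langle 0^{n'}|]U_1^\dagger]\cdots U_T^\dagger]|z\rangle .$$ **NISQ algorithms.** A $\mathsf{NISQ}_\lambda$ algorithm is a probabilistic classical algorithm which can adaptively query $f$ classically and run $\lambda$-noisy quantum circuits with oracle access, observing their output strings. The number of queries is the total number of classical queries plus oracle applications inside the circuits that are run. *)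

theory Defs
  imports
    "HOL-Probability.Probability_Mass_Function"
    "Jordan_Normal_Form.Schur_Decomposition"
begin

text \<open>
  Operators on \<open>m\<close> qubits are complex matrices of dimension \<open>2^m\<close>. Computational basis states
  are numbered little-endian: qubit \<open>j\<close> of the basis state with index \<open>k\<close> is the binary digit
  \<open>bit k j\<close>. Bit strings are lists whose entry \<open>j\<close> belongs to qubit \<open>j\<close>.
\<close>

definition basis_index :: "bool list \<Rightarrow> nat" where
  "basis_index z = horner_sum of_bool 2 z"

definition basis_bits :: "nat \<Rightarrow> nat \<Rightarrow> bool list" where
  "basis_bits m k = map (bit k) [0..<m]"

definition qubit :: "nat \<Rightarrow> nat \<Rightarrow> nat" where
  "qubit k j = of_bool (bit k j)"

definition unitary_mat :: "nat \<Rightarrow> complex mat \<Rightarrow> bool" where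
  "unitary_mat d U \<longleftrightarrow>
     U \<in> carrier_mat d d \<and> U * mat_adjoint U = 1\<^sub>m d \<and> mat_adjoint U * U = 1\<^sub>m d"

text \<open>
  Single-qubit depolarizing channel, extended linearly from density matrices to all matrices:
  \<open>(1 - \<lambda>) \<rho> + \<lambda> tr(\<rho>) I/2\<close>. The trace factor, which is 1 on density matrices, is what makes
  tensor powers of the channel meaningful.
\<close>

definition depolarize :: "real \<Rightarrow> complex mat \<Rightarrow> complex mat" where
  "depolarize lam \<rho> =
     of_real (1 - lam) \<cdot>\<^sub>m \<rho> + (of_real lam * (\<Sum>i<2. \<rho> $$ (i, i)) / 2) \<cdot>\<^sub>m 1\<^sub>m 2"

definition matrix_unit :: "nat \<Rightarrow> nat \<Rightarrow> complex mat" where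
  "matrix_unit a b = Matrix.mat 2 2 (\<lambda>ij. if ij = (a, b) then 1 else 0)"

text \<open>
  The \<open>m\<close>-fold tensor power of a linear map \<open>\<Phi>\<close> on 2 x 2 matrices: expand \<open>\<rho>\<close> in the matrix
  units \<open>|k'><l'| = \<Otimes>\<^sub>j |k'\<^sub>j><l'\<^sub>j|\<close> and apply \<open>\<Phi>\<close> to every tensor factor.
\<close>

definition tensor_power_channel ::
  "nat \<Rightarrow> (complex mat \<Rightarrow> complex mat) \<Rightarrow> complex mat \<Rightarrow> complex mat" where
  "tensor_power_channel m \<Phi> \<rho> = Matrix.mat (2 ^ m) (2 ^ m) (\<lambda>(k, l).
     \<Sum>k'<2 ^ m. \<Sum>l'<2 ^ m.
       (\<Prod>j<m. \<Phi> (matrix_unit (qubit k' j) (qubit l' j)) $$ (qubit k j, qubit l j)) *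
       \<rho> $$ (k', l'))"

text \<open>
  A gate \<open>(V, a, b)\<close> applies the two-qubit unitary \<open>V\<close> to the qubits \<open>a\<close> and \<open>b\<close>. The pairs
  may be chosen arbitrarily, but must partition the qubits \<open>0, \<dots>, m - 1\<close>; an idle pair
  carries the identity.
\<close>

definition tensor_gates :: "nat \<Rightarrow> (complex mat \<times> nat \<times> nat) list \<Rightarrow> complex mat" where
  "tensor_gates m gs = Matrix.mat (2 ^ m) (2 ^ m) (\<lambda>(k, l).
     \<Prod>(V, a, b)\<leftarrow>gs. V $$ (qubit k a + 2 * qubit k b, qubit l a + 2 * qubit l b))"

definition depth_one :: "nat \<Rightarrow> complex mat \<Rightarrow> bool" where
  "depth_one m U \<longleftrightarrow> (\<exists>gs.
     (\<forall>(V, a, b)\<in>set gs. unitary_mat 4 V) \<and>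
     distinct (concat (map (\<lambda>(V, a, b). [a, b]) gs)) \<and>
     set (concat (map (\<lambda>(V, a, b). [a, b]) gs)) = {..<m} \<and>
     U = tensor_gates m gs)"

text \<open>
  \<open>O\<^sub>f \<otimes> I\<close> on \<open>m \<ge> n + 1\<close> qubits: the first \<open>n\<close> qubits hold the argument, qubit \<open>n\<close> is the target.
\<close>

definition oracle_mat :: "nat \<Rightarrow> (bool list \<Rightarrow> bool) \<Rightarrow> nat \<Rightarrow> complex mat" where
  "oracle_mat n f m = Matrix.mat (2 ^ m) (2 ^ m) (\<lambda>(k, l).
     let z = basis_bits m l in
     if basis_bits m k = z[n := (z ! n \<noteq> f (take n z))] then 1 else 0)"

datatype layer = Unitary "complex mat" | Oracle

primrec layer_mat :: "nat \<Rightarrow> (bool list \<Rightarrow> bool) \<Rightarrow> nat \<Rightarrow> layer \<Rightarrow> complex mat" where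
  "layer_mat n f m (Unitary U) = U"
| "layer_mat n f m Oracle = oracle_mat n f m"

primrec valid_layer :: "nat \<Rightarrow> nat \<Rightarrow> layer \<Rightarrow> bool" where
  "valid_layer n m (Unitary U) \<longleftrightarrow> depth_one m U"
| "valid_layer n m Oracle \<longleftrightarrow> n + 1 \<le> m"

definition noise :: "real \<Rightarrow> nat \<Rightarrow> complex mat \<Rightarrow> complex mat" where
  "noise lam m = tensor_power_channel m (depolarize lam)"

definition noisy_layer ::
  "real \<Rightarrow> nat \<Rightarrow> (bool list \<Rightarrow> bool) \<Rightarrow> nat \<Rightarrow> layer \<Rightarrow> complex mat \<Rightarrow> complex mat" where
  "noisy_layer lam n f m L \<rho> =
     noise lam m (layer_mat n f m L * \<rho> * mat_adjoint (layer_mat n f m L))"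

definition zero_state :: "nat \<Rightarrow> complex mat" where
  "zero_state m = Matrix.mat (2 ^ m) (2 ^ m) (\<lambda>kl. if kl = (0, 0) then 1 else 0)"

text \<open>The first list element is the layer that is applied first.\<close>

definition final_state ::
  "real \<Rightarrow> nat \<Rightarrow> (bool list \<Rightarrow> bool) \<Rightarrow> nat \<Rightarrow> layer list \<Rightarrow> complex mat" where
  "final_state lam n f m Ls = fold (noisy_layer lam n f m) Ls (noise lam m (zero_state m))"

text \<open>
  If all layers are valid and \<open>0 \<le> \<lambda> \<le> 1\<close>, the final state is a density matrix, so that its
  diagonal is a probability vector; the value of \<open>embed_pmf\<close> is only meaningful then.
\<close>

definition circuit_pmf ::
  "real \<Rightarrow> nat \<Rightarrow> (bool list \<Rightarrow> bool) \<Rightarrow> nat \<Rightarrow> layer list \<Rightarrow> bool list pmf" where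
  "circuit_pmf lam n f m Ls = embed_pmf (\<lambda>z.
     if length z = m
     then Re (final_state lam n f m Ls $$ (basis_index z, basis_index z)) else 0)"

text \<open>
  A hybrid algorithm is an adaptive decision tree: it can stop with an output, toss a fair coin,
  query \<open>f\<close> classically, or run a noisy circuit on \<open>m\<close> qubits and observe the measured string.
  The tree does not depend on \<open>f\<close>.
\<close>

datatype nisq =
    Output "bool list"
  | Coin "bool \<Rightarrow> nisq"
  | Query "bool list" "bool \<Rightarrow> nisq"
  | Run nat "layer list" "bool list \<Rightarrow> nisq"

primrec nisq_algorithm :: "nat \<Rightarrow> nisq \<Rightarrow> bool" where
  "nisq_algorithm n (Output y) \<longleftrightarrow> True"
| "nisq_algorithm n (Coin k) \<longleftrightarrow> (\<forall>b. nisq_algorithm n (k b))"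
| "nisq_algorithm n (Query x k) \<longleftrightarrow> length x = n \<and> (\<forall>b. nisq_algorithm n (k b))"
| "nisq_algorithm n (Run m Ls k) \<longleftrightarrow>
     (\<forall>L\<in>set Ls. valid_layer n m L) \<and> (\<forall>z. length z = m \<longrightarrow> nisq_algorithm n (k z))"

text \<open>
  Joint distribution of the output and the number of queries made during the run, where running
  a circuit costs as many queries as it has oracle layers.
\<close>

primrec exec :: "real \<Rightarrow> nat \<Rightarrow> (bool list \<Rightarrow> bool) \<Rightarrow> nisq \<Rightarrow> (bool list \<times> nat) pmf" where
  "exec lam n f (Output y) = return_pmf (y, 0)"
| "exec lam n f (Coin k) = bind_pmf (bernoulli_pmf (1 / 2)) (\<lambda>b. exec lam n f (k b))"
| "exec lam n f (Query x k) = map_pmf (\<lambda>(y, q). (y, q + 1)) (exec lam n f (k (f x)))"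
| "exec lam n f (Run m Ls k) =
     bind_pmf (circuit_pmf lam n f m Ls)
       (\<lambda>z. map_pmf (\<lambda>(y, q). (y, q + count_list Ls Oracle)) (exec lam n f (k z)))"

definition bv_fun :: "bool list \<Rightarrow> bool list \<Rightarrow> bool" where
  "bv_fun s x \<longleftrightarrow> odd (\<Sum>i<length s. of_bool (s ! i) * of_bool (x ! i) :: nat)"

end

theory Submission
  imports Defs
begin

text \<open>
  A single Bernstein--Vazirani circuit is run on \<open>2n + 2\<close> qubits. Before the oracle the state is
  a product. Writing the noisy target qubit as a mixture of \<open>|-><-|\<close> and \<open>|+><+|\<close> makes the
  state after the oracle a mixture of two product states, since phase kickback acts by a product
  of signs; product form is preserved from then on. Hence bit \<open>i\<close> of the measured string differs
  from \<open>s\<^sub>i\<close> with probability at most \<open>(1 - (1 - \<lambda>)\<^sup>6) / 2 \<le> 3\<lambda> < 1/8\<close>, and a bitwise majority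
  vote over \<open>O(log(n/\<delta>))\<close> independent runs recovers \<open>s\<close>.
\<close>

section \<open>Operators of product form\<close>

text \<open>One-qubit operators are functions of two bits rather than 2x2 matrices. This avoids
  index bounds on the factors and lets products, adjoints and noise be computed qubit by
  qubit.\<close>

definition tensor_mat :: "nat \<Rightarrow> (nat \<Rightarrow> bool \<Rightarrow> bool \<Rightarrow> complex) \<Rightarrow> complex mat" where
  "tensor_mat m A = Matrix.mat (2 ^ m) (2 ^ m) (\<lambda>(k, l). \<Prod>j<m. A j (bit k j) (bit l j))"

lemma tensor_mat_carrier [simp]: "tensor_mat m A \<in> carrier_mat (2 ^ m) (2 ^ m)"
  by (simp add: tensor_mat_def)

lemma dim_tensor_mat [simp]:
  "dim_row (tensor_mat m A) = 2 ^ m" "dim_col (tensor_mat m A) = 2 ^ m"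
  by (simp_all add: tensor_mat_def)

lemma index_tensor_mat [simp]:
  "k < 2 ^ m \<Longrightarrow> l < 2 ^ m \<Longrightarrow> tensor_mat m A $$ (k, l) = (\<Prod>j<m. A j (bit k j) (bit l j))"
  by (simp add: tensor_mat_def)

lemma tensor_mat_cong:
  assumes "\<And>j a b. j < m \<Longrightarrow> A j a b = B j a b"
  shows "tensor_mat m A = tensor_mat m B"
  using assms by (auto simp: tensor_mat_def intro!: eq_matI prod.cong)

lemma bit_add_exp_nat:
  assumes "k < 2 ^ m" "j \<le> m"
  shows "bit (k + 2 ^ m :: nat) j \<longleftrightarrow> bit k j \<or> j = m"
proof -
  have nb: "\<not> bit k m"
    using assms(1) by (simp add: bit_iff_odd)
  have "k + 2 ^ m = set_bit m k"
    using nb by (simp add: set_bit_eq)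
  then show ?thesis
    by (auto simp: bit_set_bit_iff)
qed

text \<open>The digits of the numbers below \<open>2 ^ m\<close> run through all
  \<open>m\<close>-tuples of bits, so this is the distributive law. Matrix products and noise
  factorize over the qubits because of it.\<close>

lemma sum_prod_bits:
  fixes g :: "nat \<Rightarrow> bool \<Rightarrow> 'a :: comm_semiring_1"
  shows "(\<Sum>k<2 ^ m :: nat. \<Prod>j<m. g j (bit k j)) = (\<Prod>j<m. \<Sum>b\<in>UNIV. g j b)"
proof (induction m)
  case 0
  show ?case by simp
next
  case (Suc m)
  let ?P = "\<lambda>k :: nat. \<Prod>j<m. g j (bit k j)"
  \<comment> \<open>Split by the top digit \<open>m\<close>.\<close>
  have split: "{..<2 ^ Suc m :: nat} = {..<2 ^ m} \<union> (\<lambda>k. k + 2 ^ m) ` {..<2 ^ m}"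
  proof (intro equalityI subsetI)
    fix k :: nat
    assume "k \<in> {..<2 ^ Suc m}"
    then have "k < 2 ^ m \<or> (k - 2 ^ m < 2 ^ m \<and> k = (k - 2 ^ m) + 2 ^ m)"
      by auto
    then show "k \<in> {..<2 ^ m} \<union> (\<lambda>k. k + 2 ^ m) ` {..<2 ^ m}"
      by blast
  qed auto
  have low: "\<not> bit k m" if "k < 2 ^ m" for k :: nat
    using that by (simp add: bit_iff_odd)
  have "(\<Sum>k<2 ^ Suc m :: nat. \<Prod>j<Suc m. g j (bit k j)) =
      (\<Sum>k<2 ^ m. ?P k * g m (bit k m)) + (\<Sum>k<2 ^ m. ?P (k + 2 ^ m) * g m (bit (k + 2 ^ m) m))"
    unfolding split by (subst sum.union_disjoint) (auto simp: sum.reindex)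
  also have "(\<Sum>k<2 ^ m. ?P k * g m (bit k m)) = (\<Sum>k<2 ^ m. ?P k * g m False)"
    by (rule sum.cong) (simp_all add: low)
  also have "(\<Sum>k<2 ^ m. ?P (k + 2 ^ m) * g m (bit (k + 2 ^ m) m)) = (\<Sum>k<2 ^ m. ?P k * g m True)"
    by (intro sum.cong arg_cong2[where f = "(*)"] prod.cong refl) (auto simp: bit_add_exp_nat)
  finally show ?case
    by (simp add: Suc.IH UNIV_bool flip: sum_distrib_right distrib_left)
qed

lemma sum_prod_bits2:
  fixes g :: "nat \<Rightarrow> bool \<Rightarrow> bool \<Rightarrow> 'a :: comm_semiring_1"
  shows "(\<Sum>k<2 ^ m :: nat. \<Sum>l<2 ^ m :: nat. \<Prod>j<m. g j (bit k j) (bit l j)) =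
    (\<Prod>j<m. \<Sum>a\<in>UNIV. \<Sum>b\<in>UNIV. g j a b)"
proof -
  have "(\<Sum>k<2 ^ m :: nat. \<Sum>l<2 ^ m :: nat. \<Prod>j<m. g j (bit k j) (bit l j)) =
      (\<Sum>k<2 ^ m :: nat. \<Prod>j<m. \<Sum>b\<in>UNIV. g j (bit k j) b)"
    by (rule sum.cong[OF refl], rule sum_prod_bits)
  also have "\<dots> = (\<Prod>j<m. \<Sum>a\<in>UNIV. \<Sum>b\<in>UNIV. g j a b)"
    by (rule sum_prod_bits)
  finally show ?thesis .
qed

lemma tensor_mat_mult:
  "tensor_mat m A * tensor_mat m B = tensor_mat m (\<lambda>j a b. \<Sum>c\<in>UNIV. A j a c * B j c b)"
proof (rule eq_matI)
  fix k l :: nat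
  assume "k < dim_row (tensor_mat m (\<lambda>j a b. \<Sum>c\<in>UNIV. A j a c * B j c b))"
    and "l < dim_col (tensor_mat m (\<lambda>j a b. \<Sum>c\<in>UNIV. A j a c * B j c b))"
  then have kl: "k < 2 ^ m" "l < 2 ^ m" by simp_all
  have "(tensor_mat m A * tensor_mat m B) $$ (k, l) =
      (\<Sum>i<2 ^ m :: nat. \<Prod>j<m. A j (bit k j) (bit i j) * B j (bit i j) (bit l j))"
    using kl by (simp add: scalar_prod_def prod.distrib lessThan_atLeast0)
  also have "\<dots> = (\<Prod>j<m. \<Sum>c\<in>UNIV. A j (bit k j) c * B j c (bit l j))"
    by (rule sum_prod_bits)
  finally show "(tensor_mat m A * tensor_mat m B) $$ (k, l) =
      tensor_mat m (\<lambda>j a b. \<Sum>c\<in>UNIV. A j a c * B j c b) $$ (k, l)"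
    using kl by simp
qed simp_all

lemma mat_adjoint_carrier [simp]: "A \<in> carrier_mat d e \<Longrightarrow> mat_adjoint A \<in> carrier_mat e d"
  by (auto simp: mat_adjoint_def)

lemma dim_mat_adjoint [simp]:
  "dim_row (mat_adjoint A) = dim_col A" "dim_col (mat_adjoint A) = dim_row A"
  by (simp_all add: mat_adjoint_def)

lemma index_mat_adjoint [simp]:
  "k < dim_col A \<Longrightarrow> l < dim_row A \<Longrightarrow> mat_adjoint A $$ (k, l) = conjugate (A $$ (l, k))"
  by (simp add: mat_adjoint_def mat_of_rows_index)

lemma mat_adjoint_tensor_mat:
  "mat_adjoint (tensor_mat m A) = tensor_mat m (\<lambda>j a b. cnj (A j b a))"
  by (rule eq_matI) simp_all

lemma tensor_mat_one: "tensor_mat m (\<lambda>j a b. of_bool (a = b)) = 1\<^sub>m (2 ^ m)"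
proof (rule eq_matI)
  fix k l :: nat
  assume "k < dim_row (1\<^sub>m (2 ^ m) :: complex mat)" "l < dim_col (1\<^sub>m (2 ^ m) :: complex mat)"
  then have kl: "k < 2 ^ m" "l < 2 ^ m" by simp_all
  have "k = l" if "\<forall>j<m. bit k j = bit l j"
  proof -
    have "take_bit m k = take_bit m l"
      using that by (intro bit_eqI) (auto simp: bit_take_bit_iff)
    then show ?thesis
      using kl by (simp add: take_bit_nat_eq_self)
  qed
  then have "(\<Prod>j<m. of_bool (bit k j = bit l j)) = (of_bool (k = l) :: complex)"
    by (cases "k = l") auto
  then show "tensor_mat m (\<lambda>j a b. of_bool (a = b)) $$ (k, l) = 1\<^sub>m (2 ^ m) $$ (k, l)"
    using kl by simp
qed simp_all

lemma zero_state_eq: "zero_state m = tensor_mat m (\<lambda>j a b. of_bool (\<not> a \<and> \<not> b))"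
proof (rule eq_matI)
  fix k l :: nat
  assume "k < dim_row (tensor_mat m (\<lambda>j a b. of_bool (\<not> a \<and> \<not> b)))"
    "l < dim_col (tensor_mat m (\<lambda>j a b. of_bool (\<not> a \<and> \<not> b)))"
  then have kl: "k < 2 ^ m" "l < 2 ^ m" by simp_all
  have "i = 0" if "i < 2 ^ m" "\<forall>j<m. \<not> bit i j" for i :: nat
  proof -
    have "take_bit m i = 0"
      using that(2) by (intro bit_eqI) (auto simp: bit_take_bit_iff)
    then show ?thesis
      using that(1) by (simp add: take_bit_nat_eq_self)
  qed
  then have "(\<Prod>j<m. of_bool (\<not> bit k j \<and> \<not> bit l j)) = (of_bool (k = 0 \<and> l = 0) :: complex)"
    using kl by (cases "k = 0 \<and> l = 0") auto
  then show "zero_state m $$ (k, l) = tensor_mat m (\<lambda>j a b. of_bool (\<not> a \<and> \<not> b)) $$ (k, l)"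
    using kl by (simp add: zero_state_def)
qed (simp_all add: zero_state_def)

section \<open>Noise and layers acting on product operators\<close>

definition dep :: "real \<Rightarrow> (bool \<Rightarrow> bool \<Rightarrow> complex) \<Rightarrow> bool \<Rightarrow> bool \<Rightarrow> complex" where
  "dep lam A a b =
     of_real (1 - lam) * A a b + of_bool (a = b) * (of_real lam * (A False False + A True True) / 2)"

lemma index_depolarize_matrix_unit:
  "depolarize lam (matrix_unit (of_bool c) (of_bool d)) $$ (of_bool a, of_bool b) =
    of_real (1 - lam) * of_bool (a = c \<and> b = d) + of_bool (a = b \<and> c = d) * (of_real lam / 2)"
proof -
  have tr: "(\<Sum>i<2. matrix_unit (of_bool c) (of_bool d) $$ (i, i)) = of_bool (c = d)"
    by (cases c; cases d) (simp_all add: matrix_unit_def numeral_2_eq_2)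
  show ?thesis
    unfolding depolarize_def tr
    by (cases a; cases b; cases c; cases d) (simp_all add: matrix_unit_def)
qed

lemma depolarize_matrix_unit_sum:
  "(\<Sum>c\<in>UNIV. \<Sum>d\<in>UNIV.
      depolarize lam (matrix_unit (of_bool c) (of_bool d)) $$ (of_bool a, of_bool b) * A c d) =
    dep lam A a b"
  unfolding index_depolarize_matrix_unit dep_def UNIV_bool
  by (cases a; cases b) (simp_all add: field_simps)

text \<open>Channel coefficients and matrix entries are both products over the qubits, so the double
  sum splits into one-qubit sums, each expanding \<open>A j\<close> in matrix units.\<close>

lemma noise_tensor_mat: "noise lam m (tensor_mat m A) = tensor_mat m (\<lambda>j. dep lam (A j))"
proof (rule eq_matI)
  fix k l :: nat
  assume "k < dim_row (tensor_mat m (\<lambda>j. dep lam (A j)))"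
    "l < dim_col (tensor_mat m (\<lambda>j. dep lam (A j)))"
  then have kl: "k < 2 ^ m" "l < 2 ^ m" by simp_all
  let ?d = "\<lambda>c d a b. depolarize lam (matrix_unit (of_bool c) (of_bool d)) $$ (of_bool a, of_bool b)"
  have "noise lam m (tensor_mat m A) $$ (k, l) =
      (\<Sum>k'<2 ^ m :: nat. \<Sum>l'<2 ^ m :: nat. \<Prod>j<m. ?d (bit k' j) (bit l' j) (bit k j) (bit l j) * A j (bit k' j) (bit l' j))"
    using kl by (simp add: noise_def tensor_power_channel_def qubit_def prod.distrib)
  also have "\<dots> = (\<Prod>j<m. \<Sum>c\<in>UNIV. \<Sum>d\<in>UNIV. ?d c d (bit k j) (bit l j) * A j c d)"
    by (rule sum_prod_bits2)
  also have "\<dots> = (\<Prod>j<m. dep lam (A j) (bit k j) (bit l j))"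
    by (simp only: depolarize_matrix_unit_sum)
  finally show "noise lam m (tensor_mat m A) $$ (k, l) = tensor_mat m (\<lambda>j. dep lam (A j)) $$ (k, l)"
    using kl by simp
qed (simp_all add: noise_def tensor_power_channel_def)

text \<open>Linearity extends the calculus to the mixture of two product operators that the oracle
  creates.\<close>

lemma noise_combine:
  assumes "A \<in> carrier_mat (2 ^ m) (2 ^ m)" "B \<in> carrier_mat (2 ^ m) (2 ^ m)"
  shows "noise lam m (x \<cdot>\<^sub>m A + y \<cdot>\<^sub>m B) = x \<cdot>\<^sub>m noise lam m A + y \<cdot>\<^sub>m noise lam m B"
proof (rule eq_matI)
  fix k l :: nat
  assume "k < dim_row (x \<cdot>\<^sub>m noise lam m A + y \<cdot>\<^sub>m noise lam m B)"
    "l < dim_col (x \<cdot>\<^sub>m noise lam m A + y \<cdot>\<^sub>m noise lam m B)"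
  then have kl: "k < 2 ^ m" "l < 2 ^ m"
    by (simp_all add: noise_def tensor_power_channel_def)
  have *: "P * (x * a + y * b) = x * (P * a) + y * (P * b)" for P a b :: complex
    by (simp add: algebra_simps)
  show "noise lam m (x \<cdot>\<^sub>m A + y \<cdot>\<^sub>m B) $$ (k, l) =
      (x \<cdot>\<^sub>m noise lam m A + y \<cdot>\<^sub>m noise lam m B) $$ (k, l)"
    using kl assms
    by (simp add: noise_def tensor_power_channel_def * sum.distrib flip: sum_distrib_left)
qed (simp_all add: noise_def tensor_power_channel_def)

lemma noise_carrier [simp]: "noise lam m A \<in> carrier_mat (2 ^ m) (2 ^ m)"
  by (simp add: noise_def tensor_power_channel_def)

definition conj1 :: "(bool \<Rightarrow> bool \<Rightarrow> complex) \<Rightarrow> (bool \<Rightarrow> bool \<Rightarrow> complex) \<Rightarrow> bool \<Rightarrow> bool \<Rightarrow> complex" where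
  "conj1 G A a b = (\<Sum>d\<in>UNIV. (\<Sum>c\<in>UNIV. G a c * A c d) * cnj (G b d))"

lemma noisy_layer_tensor_mat:
  "noisy_layer lam n f m (Unitary (tensor_mat m G)) (tensor_mat m A) =
    tensor_mat m (\<lambda>j. dep lam (conj1 (G j) (A j)))"
  unfolding noisy_layer_def layer_mat.simps mat_adjoint_tensor_mat tensor_mat_mult noise_tensor_mat
  by (rule tensor_mat_cong) (simp add: conj1_def dep_def)

lemma noisy_layer_combine:
  assumes "A \<in> carrier_mat (2 ^ m) (2 ^ m)" "B \<in> carrier_mat (2 ^ m) (2 ^ m)"
    "layer_mat n f m L \<in> carrier_mat (2 ^ m) (2 ^ m)"
  shows "noisy_layer lam n f m L (x \<cdot>\<^sub>m A + y \<cdot>\<^sub>m B) =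
    x \<cdot>\<^sub>m noisy_layer lam n f m L A + y \<cdot>\<^sub>m noisy_layer lam n f m L B"
proof -
  let ?U = "layer_mat n f m L" and ?d = "2 ^ m :: nat"
  have "?U * (x \<cdot>\<^sub>m A + y \<cdot>\<^sub>m B) = x \<cdot>\<^sub>m (?U * A) + y \<cdot>\<^sub>m (?U * B)"
    using assms by (simp add: mult_add_distrib_mat[of _ ?d ?d _ ?d] mult_smult_distrib[of _ ?d ?d _ ?d])
  also have "\<dots> * mat_adjoint ?U = x \<cdot>\<^sub>m (?U * A * mat_adjoint ?U) + y \<cdot>\<^sub>m (?U * B * mat_adjoint ?U)"
    using assms
    by (simp add: add_mult_distrib_mat[of _ ?d ?d _ _ ?d] mult_smult_assoc_mat[of _ ?d ?d _ ?d])
  finally show ?thesis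
    unfolding noisy_layer_def
    by (simp only:) (intro noise_combine mult_carrier_mat[of _ ?d ?d] mat_adjoint_carrier assms)
qed

section \<open>The oracle\<close>

text \<open>The oracle permutes basis states; this is the permutation of their indices. It leaves
  the argument digits alone and is therefore an involution.\<close>

definition oracle_perm :: "nat \<Rightarrow> (bool list \<Rightarrow> bool) \<Rightarrow> nat \<Rightarrow> nat" where
  "oracle_perm n f k = (if f (basis_bits n k) then flip_bit n k else k)"

lemma bit_oracle_perm:
  "bit (oracle_perm n f k) j \<longleftrightarrow> bit k j \<noteq> (j = n \<and> f (basis_bits n k))"
  by (auto simp: oracle_perm_def bit_flip_bit_iff)

lemma basis_bits_oracle_perm: "basis_bits n (oracle_perm n f k) = basis_bits n k"
  by (auto simp: basis_bits_def bit_oracle_perm)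

lemma oracle_perm_involution: "oracle_perm n f (oracle_perm n f k) = k"
  by (rule bit_eqI) (auto simp: bit_oracle_perm basis_bits_oracle_perm)

lemma less_exp_iff_bits: "k < 2 ^ m \<longleftrightarrow> (\<forall>j\<ge>m. \<not> bit (k :: nat) j)"
proof
  assume "k < 2 ^ m"
  then have "k < 2 ^ j" if "j \<ge> m" for j
    using that by (meson less_le_trans one_le_numeral power_increasing)
  then show "\<forall>j\<ge>m. \<not> bit k j"
    by (simp add: bit_iff_odd)
next
  assume *: "\<forall>j\<ge>m. \<not> bit k j"
  have "take_bit m k = k"
    by (rule bit_eqI) (use * not_le in \<open>auto simp: bit_take_bit_iff\<close>)
  then show "k < 2 ^ m"
    by (simp add: take_bit_nat_eq_self_iff)
qed

lemma oracle_perm_less: "k < 2 ^ m \<Longrightarrow> n < m \<Longrightarrow> oracle_perm n f k < 2 ^ m"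
  by (auto simp: less_exp_iff_bits bit_oracle_perm)

lemma basis_bits_eq_iff:
  assumes "k < 2 ^ m" "l < 2 ^ m"
  shows "basis_bits m k = basis_bits m l \<longleftrightarrow> k = l"
proof
  assume "basis_bits m k = basis_bits m l"
  then have "horner_sum of_bool 2 (basis_bits m k) = (horner_sum of_bool 2 (basis_bits m l) :: nat)"
    by simp
  then show "k = l"
    using assms by (simp add: basis_bits_def horner_sum_bit_eq_take_bit take_bit_nat_eq_self)
qed simp

lemma index_oracle_mat:
  assumes "k < 2 ^ m" "l < 2 ^ m" "n < m"
  shows "oracle_mat n f m $$ (k, l) = of_bool (l = oracle_perm n f k)"
proof -
  have take: "take n (basis_bits m l) = basis_bits n l"
    using assms by (simp add: basis_bits_def take_map)
  have "(basis_bits m l)[n := (basis_bits m l ! n \<noteq> f (take n (basis_bits m l)))] =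
      basis_bits m (oracle_perm n f l)"
    unfolding take
    using assms by (intro nth_equalityI) (auto simp: basis_bits_def nth_list_update bit_oracle_perm)
  then have "oracle_mat n f m $$ (k, l) = of_bool (k = oracle_perm n f l)"
    using assms by (simp add: oracle_mat_def Let_def basis_bits_eq_iff oracle_perm_less)
  \<comment> \<open>Solving for the column index lets a fixed row pick out a single summand in
    matrix products.\<close>
  also have "k = oracle_perm n f l \<longleftrightarrow> l = oracle_perm n f k"
    by (metis oracle_perm_involution)
  finally show ?thesis .
qed

lemma oracle_mat_carrier [simp]: "oracle_mat n f m \<in> carrier_mat (2 ^ m) (2 ^ m)"
  by (simp add: oracle_mat_def)

lemma dim_oracle_mat [simp]:
  "dim_row (oracle_mat n f m) = 2 ^ m" "dim_col (oracle_mat n f m) = 2 ^ m"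
  by (simp_all add: oracle_mat_def)

lemma index_mult_mat_sum:
  assumes "A \<in> carrier_mat d e" "B \<in> carrier_mat e d'" "k < d" "l < d'"
  shows "(A * B) $$ (k, l) = (\<Sum>i<e. A $$ (k, i) * B $$ (i, l))"
  using assms by (auto simp: scalar_prod_def lessThan_atLeast0)

text \<open>Conjugation by a permutation matrix relabels rows and columns: each of the two sums
  collapses to one term.\<close>

lemma index_oracle_conj:
  assumes "k < 2 ^ m" "l < 2 ^ m" "n < m" "A \<in> carrier_mat (2 ^ m) (2 ^ m)"
  shows "(oracle_mat n f m * A * mat_adjoint (oracle_mat n f m)) $$ (k, l) =
    A $$ (oracle_perm n f k, oracle_perm n f l)"
proof -
  let ?O = "oracle_mat n f m" and ?d = "2 ^ m :: nat"
  have half: "(?O * A) $$ (k, i) = A $$ (oracle_perm n f k, i)" if "i < ?d" for i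
  proof -
    have "(?O * A) $$ (k, i) = (\<Sum>j<?d. of_bool (j = oracle_perm n f k) * A $$ (j, i))"
      using assms that by (simp add: index_mult_mat_sum[of _ ?d ?d _ ?d] index_oracle_mat del: index_mult_mat)
    also have "\<dots> = (\<Sum>j<?d. if j = oracle_perm n f k then A $$ (j, i) else 0)"
      by (rule sum.cong) auto
    also have "\<dots> = A $$ (oracle_perm n f k, i)"
      using assms by (simp add: oracle_perm_less)
    finally show ?thesis .
  qed
  have "(?O * A * mat_adjoint ?O) $$ (k, l) = (\<Sum>i<?d. (?O * A) $$ (k, i) * mat_adjoint ?O $$ (i, l))"
    using assms by (intro index_mult_mat_sum) (auto intro!: mult_carrier_mat[of _ ?d ?d])
  also have "\<dots> = (\<Sum>i<?d. if i = oracle_perm n f l then A $$ (oracle_perm n f k, i) else 0)"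
    using assms by (intro sum.cong) (auto simp: half index_oracle_mat simp del: index_mult_mat)
  also have "\<dots> = A $$ (oracle_perm n f k, oracle_perm n f l)"
    using assms by (simp add: oracle_perm_less)
  finally show ?thesis .
qed

text \<open>The bijection between indices and strings transfers \<open>sum_prod_bits\<close> to
  measured strings, where it yields total mass and marginals.\<close>

lemma sum_prod_bool_lists:
  fixes g :: "nat \<Rightarrow> bool \<Rightarrow> 'a :: comm_semiring_1"
  shows "(\<Sum>z | length z = m. \<Prod>j<m. g j (z ! j)) = (\<Prod>j<m. \<Sum>b\<in>UNIV. g j b)"
proof -
  have "(\<Sum>z | length z = m. \<Prod>j<m. g j (z ! j)) = (\<Sum>k<2 ^ m :: nat. \<Prod>j<m. g j (bit k j))"
    by (rule sum.reindex_bij_witness[of _ "basis_bits m" basis_index])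
      (auto simp: basis_bits_def basis_index_def horner_sum_bit_eq_take_bit take_bit_nat_eq_self
        bit_horner_sum_bit_iff less_exp_iff_bits intro!: nth_equalityI prod.cong)
  then show ?thesis
    by (simp add: sum_prod_bits)
qed

section \<open>Depth-one layers of single-qubit gates\<close>

definition qubit_unitary :: "(bool \<Rightarrow> bool \<Rightarrow> complex) \<Rightarrow> bool" where
  "qubit_unitary G \<longleftrightarrow> (\<forall>a b. (\<Sum>c\<in>UNIV. G a c * cnj (G b c)) = of_bool (a = b) \<and>
     (\<Sum>c\<in>UNIV. cnj (G c a) * G c b) = of_bool (a = b))"

lemma unitary_mat_tensor_mat:
  assumes "\<And>j. j < m \<Longrightarrow> qubit_unitary (G j)"
  shows "unitary_mat (2 ^ m) (tensor_mat m G)"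
  unfolding unitary_mat_def mat_adjoint_tensor_mat tensor_mat_mult
  using assms
  by (simp add: qubit_unitary_def cong: tensor_mat_cong flip: tensor_mat_one)

lemma concat_pairs_upt: "concat (map (\<lambda>j. [2 * j, Suc (2 * j)]) [0..<M]) = [0..<2 * M]"
  by (induction M) simp_all

lemma prod_pairs_upt:
  "(\<Prod>j<2 * M. g j) = (\<Prod>j\<leftarrow>[0..<M]. g (2 * j) * (g (Suc (2 * j)) :: 'a :: comm_monoid_mult))"
  by (induction M) (simp_all add: mult.assoc)

text \<open>\<open>depth_one\<close> asks for two-qubit gates that partition the qubits. Neighbours
  \<open>2 * i\<close> and \<open>2 * i + 1\<close> are paired and receive the tensor product of
  their gates; hence the even number of qubits.\<close>

lemma depth_one_tensor_mat:
  assumes "\<And>j. j < 2 * M \<Longrightarrow> qubit_unitary (G j)"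
  shows "depth_one (2 * M) (tensor_mat (2 * M) G)"
proof -
  define V where "V i = tensor_mat 2 (\<lambda>j. G (2 * i + j))" for i
  define gs where "gs = map (\<lambda>i. (V i, 2 * i, Suc (2 * i))) [0..<M]"
  have V: "unitary_mat 4 (V i)" if "i < M" for i
    using unitary_mat_tensor_mat[of 2 "\<lambda>j. G (2 * i + j)"] assms that by (simp add: V_def)
  have entry: "V i $$ (of_bool a + 2 * of_bool b, of_bool c + 2 * of_bool d) =
      G (2 * i) a c * G (Suc (2 * i)) b d" for i a b c d
  proof -
    have small: "of_bool x + 2 * of_bool y < (2 ^ 2 :: nat)" for x y
      by (cases x; cases y) simp_all
    have bits: "bit (of_bool x + 2 * of_bool y :: nat) 0 = x" "bit (of_bool x + 2 * of_bool y :: nat) (Suc 0) = y" for x y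
      by (cases x; cases y; simp add: bit_0 bit_Suc)+
    have prod2: "(\<Prod>j<2. h j) = h 0 * h (Suc 0)" for h :: "nat \<Rightarrow> complex"
      by (simp add: numeral_2_eq_2)
    show ?thesis
      unfolding V_def
      by (subst index_tensor_mat[OF small small])
        (simp only: prod2 bits add_0_right add_Suc_right)
  qed
  have "tensor_mat (2 * M) G = tensor_gates (2 * M) gs"
    by (rule eq_matI)
      (simp_all add: tensor_gates_def gs_def prod_pairs_upt o_def qubit_def entry del: prod.lessThan_Suc)
  moreover have "concat (map (\<lambda>(V, a, b). [a, b]) gs) = [0..<2 * M]"
    by (simp add: gs_def o_def concat_pairs_upt)
  ultimately show ?thesis
    unfolding depth_one_def using V
    by (intro exI[of _ gs]) (auto simp: gs_def)
qed

section \<open>The noisy Bernstein--Vazirani circuit\<close>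

text \<open>The operator (I + x Z) / 2; x = 1 is |0><0|.\<close>

definition z_state :: "real \<Rightarrow> bool \<Rightarrow> bool \<Rightarrow> complex" where
  "z_state x a b = (if a \<noteq> b then 0 else of_real ((1 + (if a then - x else x)) / 2))"

text \<open>The operator (I + x X) / 2; x = 1 and x = -1 are |+><+| and |-><-|.\<close>

definition x_state :: "real \<Rightarrow> bool \<Rightarrow> bool \<Rightarrow> complex" where
  "x_state x a b = of_real ((if a = b then 1 else x) / 2)"

text \<open>For \<sigma> = 1 the Hadamard gate H, for \<sigma> = -1 the gate H X, which takes |0> to
  |->. So one layer prepares arguments and target together, without an extra round of noise.\<close>

definition hadamard :: "real \<Rightarrow> bool \<Rightarrow> bool \<Rightarrow> complex" where
  "hadamard \<sigma> a b = of_real ((if a then if b then - \<sigma> else \<sigma> else 1) / sqrt 2)"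

text \<open>Grouping the entries of \<open>hadamard\<close> in pairs removes the square roots from
  the computations below.\<close>

lemma of_real_div_sqrt2: "complex_of_real (x / sqrt 2) * complex_of_real (y / sqrt 2) = of_real (x * y / 2)"
  by (simp flip: of_real_mult)

lemma qubit_unitary_hadamard:
  assumes "\<sigma> = 1 \<or> \<sigma> = - 1"
  shows "qubit_unitary (hadamard \<sigma>)"
  unfolding qubit_unitary_def hadamard_def complex_cnj_complex_of_real of_real_div_sqrt2
  using assms by (auto simp: UNIV_bool)

lemma conj1_hadamard_z_state:
  assumes "\<sigma> = 1 \<or> \<sigma> = - 1"
  shows "conj1 (hadamard \<sigma>) (z_state x) = x_state (\<sigma> * x)"
proof (intro ext)
  fix a b
  have "conj1 (hadamard \<sigma>) (z_state x) a b =
      (\<Sum>d\<in>UNIV. z_state x d d * (hadamard \<sigma> a d * cnj (hadamard \<sigma> b d)))"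
    unfolding conj1_def UNIV_bool by (simp add: z_state_def algebra_simps)
  also have "\<dots> = x_state (\<sigma> * x) a b"
    unfolding hadamard_def complex_cnj_complex_of_real of_real_div_sqrt2 UNIV_bool
    using assms by (cases a; cases b) (auto simp: z_state_def x_state_def field_simps)
  finally show "conj1 (hadamard \<sigma>) (z_state x) a b = x_state (\<sigma> * x) a b" .
qed

lemma conj1_hadamard_x_state: "conj1 (hadamard 1) (x_state x) = z_state x"
proof (intro ext)
  fix a b
  have "conj1 (hadamard 1) (x_state x) a b =
      (\<Sum>d\<in>UNIV. \<Sum>c\<in>UNIV. x_state x c d * (hadamard 1 a c * cnj (hadamard 1 b d)))"
    unfolding conj1_def UNIV_bool by (simp add: algebra_simps)
  also have "\<dots> = z_state x a b"
    unfolding hadamard_def complex_cnj_complex_of_real of_real_div_sqrt2 UNIV_bool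
    by (cases a; cases b) (auto simp: z_state_def x_state_def field_simps)
  finally show "conj1 (hadamard 1) (x_state x) a b = z_state x a b" .
qed

text \<open>Depolarizing contracts the Bloch coordinate by 1 - \<lambda>, so tracking noise amounts
  to counting such factors.\<close>

lemma dep_z_state: "dep lam (z_state x) = z_state ((1 - lam) * x)"
  by (intro ext) (auto simp: dep_def z_state_def field_simps)

lemma dep_x_state: "dep lam (x_state x) = x_state ((1 - lam) * x)"
  by (intro ext) (auto simp: dep_def x_state_def field_simps)

lemma noise_zero_state: "noise lam m (zero_state m) = tensor_mat m (\<lambda>j. z_state (1 - lam))"
proof -
  have "(\<lambda>a b. of_bool (\<not> a \<and> \<not> b)) = z_state 1"
    by (intro ext) (auto simp: z_state_def)
  then show ?thesis
    by (simp add: zero_state_eq noise_tensor_mat dep_z_state)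
qed

text \<open>The sign of a parity is multiplicative over the positions; this is why phase kickback
  respects product form.\<close>

lemma bv_fun_sign:
  "(if bv_fun s x then - 1 else 1) = (\<Prod>j<length s. if s ! j \<and> x ! j then - 1 else 1 :: 'a :: comm_ring_1)"
proof -
  have "(if odd (\<Sum>j<N. of_bool (s ! j) * of_bool (x ! j) :: nat) then - 1 else 1) =
      (\<Prod>j<N. if s ! j \<and> x ! j then - 1 else 1 :: 'a)" for N
    by (induction N) auto
  then show ?thesis
    by (simp add: bv_fun_def)
qed

lemma bv_fun_sign_eq:
  assumes "length s = n"
  shows "(\<Prod>j<n. if s ! j \<and> bit k j \<noteq> bit l j then - 1 else 1) =
    (if bv_fun s (basis_bits n k) = bv_fun s (basis_bits n l) then 1 else - 1 :: 'a :: comm_ring_1)"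
proof -
  let ?sg = "\<lambda>b. if b then - 1 else 1 :: 'a"
  have "(\<Prod>j<n. ?sg (s ! j \<and> bit k j \<noteq> bit l j)) =
      (\<Prod>j<n. ?sg (s ! j \<and> basis_bits n k ! j)) * (\<Prod>j<n. ?sg (s ! j \<and> basis_bits n l ! j))"
    unfolding prod.distrib[symmetric] by (rule prod.cong) (auto simp: basis_bits_def)
  also have "\<dots> = ?sg (bv_fun s (basis_bits n k)) * ?sg (bv_fun s (basis_bits n l))"
    using assms by (simp only: bv_fun_sign)
  finally show ?thesis
    by (auto split: if_splits)
qed

text \<open>The target (I - c X) / 2 is the mixture of |-><-| and |+><+| with weights (1 + c) / 2
  and (1 - c) / 2. On |-> kickback negates the coordinate of each argument qubit with a 1 in
  \<open>s\<close>; on |+> the oracle does nothing.\<close>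

lemma oracle_on_x_states:
  assumes "length s = n" "n < m"
  shows "oracle_mat n (bv_fun s) m * tensor_mat m (\<lambda>j. x_state (if j = n then - c else c)) *
      mat_adjoint (oracle_mat n (bv_fun s) m) =
    of_real ((1 + c) / 2) \<cdot>\<^sub>m
      tensor_mat m (\<lambda>j. x_state (if j = n then - 1 else if j < n \<and> s ! j then - c else c)) +
    of_real ((1 - c) / 2) \<cdot>\<^sub>m tensor_mat m (\<lambda>j. x_state (if j = n then 1 else c))"
    (is "?O * ?X * _ = _ \<cdot>\<^sub>m ?A + _ \<cdot>\<^sub>m ?B")
proof (rule eq_matI)
  fix k l :: nat
  assume "k < dim_row (of_real ((1 + c) / 2) \<cdot>\<^sub>m ?A + of_real ((1 - c) / 2) \<cdot>\<^sub>m ?B)"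
    "l < dim_col (of_real ((1 + c) / 2) \<cdot>\<^sub>m ?A + of_real ((1 - c) / 2) \<cdot>\<^sub>m ?B)"
  then have kl: "k < 2 ^ m" "l < 2 ^ m" by simp_all
  let ?f = "bv_fun s" and ?R = "{..<m} - {n}"
  \<comment> \<open>\<open>P\<close> collects the qubits whose digits the oracle leaves
    unchanged.\<close>
  define P where "P = (\<Prod>j\<in>?R. x_state c (bit k j) (bit l j))"
  define e where "e \<longleftrightarrow> ?f (basis_bits n k) = ?f (basis_bits n l)"
  have n: "finite {..<m}" "n \<in> {..<m}" using assms by auto
  have X: "?X $$ (oracle_perm n ?f k, oracle_perm n ?f l) =
      x_state (- c) (bit k n \<noteq> ?f (basis_bits n k)) (bit l n \<noteq> ?f (basis_bits n l)) * P"
    using kl assms by (simp add: oracle_perm_less prod.remove[OF n] P_def bit_oracle_perm)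
  have B: "?B $$ (k, l) = x_state 1 (bit k n) (bit l n) * P"
    using kl assms by (simp add: prod.remove[OF n] P_def)
  have "(\<Prod>j\<in>?R. x_state (if j < n \<and> s ! j then - c else c) (bit k j) (bit l j)) =
      P * (\<Prod>j\<in>?R. if j < n \<and> s ! j \<and> bit k j \<noteq> bit l j then - 1 else 1)"
    unfolding P_def prod.distrib[symmetric] by (rule prod.cong) (auto simp: x_state_def)
  also have "(\<Prod>j\<in>?R. if j < n \<and> s ! j \<and> bit k j \<noteq> bit l j then - 1 else 1) =
      (\<Prod>j<n. if s ! j \<and> bit k j \<noteq> bit l j then - 1 else 1 :: complex)"
    using assms by (intro prod.mono_neutral_cong_right) auto
  also have "\<dots> = (if e then 1 else - 1)"
    unfolding e_def by (rule bv_fun_sign_eq[OF assms(1)])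
  finally have A: "?A $$ (k, l) = x_state (- 1) (bit k n) (bit l n) * (P * (if e then 1 else - 1))"
    using kl assms by (simp add: prod.remove[OF n])
  have "(?O * ?X * mat_adjoint ?O) $$ (k, l) = ?X $$ (oracle_perm n ?f k, oracle_perm n ?f l)"
    using kl assms by (intro index_oracle_conj) simp_all
  \<comment> \<open>With \<open>P\<close> common to all terms, an identity in the two target digits
    and the two function values remains.\<close>
  also have "\<dots> = of_real ((1 + c) / 2) * ?A $$ (k, l) + of_real ((1 - c) / 2) * ?B $$ (k, l)"
    unfolding X A B e_def
    by (cases "bit k n"; cases "bit l n"; cases "?f (basis_bits n k)"; cases "?f (basis_bits n l)")
      (simp_all add: x_state_def field_simps)
  finally show "(?O * ?X * mat_adjoint ?O) $$ (k, l) =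
      (of_real ((1 + c) / 2) \<cdot>\<^sub>m ?A + of_real ((1 - c) / 2) \<cdot>\<^sub>m ?B) $$ (k, l)"
    using kl by (simp del: index_tensor_mat)
qed simp_all

definition bv_circuit :: "nat \<Rightarrow> nat \<Rightarrow> layer list" where
  "bv_circuit n m =
    [Unitary (tensor_mat m (\<lambda>j. hadamard (if j = n then - 1 else 1))), Oracle,
     Unitary (tensor_mat m (\<lambda>j. hadamard 1))]"

text \<open>Two rounds of noise precede the oracle and two follow it. The former give the
  \<open>c\<close> inside the coordinates and the mixture weights, the latter the outer factor
  \<open>c\<close>.\<close>

lemma final_state_bv_circuit:
  fixes lam :: real
  assumes "length s = n" "n < m"
  defines "c \<equiv> (1 - lam) ^ 2"
  shows "final_state lam n (bv_fun s) m (bv_circuit n m) =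
    of_real ((1 + c) / 2) \<cdot>\<^sub>m
      tensor_mat m (\<lambda>j. z_state (c * (if j = n then - 1 else if j < n \<and> s ! j then - c else c))) +
    of_real ((1 - c) / 2) \<cdot>\<^sub>m tensor_mat m (\<lambda>j. z_state (c * (if j = n then 1 else c)))"
proof -
  let ?H = "Unitary (tensor_mat m (\<lambda>j. hadamard 1))"
  let ?N = "noisy_layer lam n (bv_fun s) m"
  let ?v = "\<lambda>j. if j = n then - 1 else if j < n \<and> s ! j then - c else c"
  let ?w = "\<lambda>j. if j = n then 1 else c"
  have 1: "?N (Unitary (tensor_mat m (\<lambda>j. hadamard (if j = n then - 1 else 1)))) (noise lam m (zero_state m)) =
      tensor_mat m (\<lambda>j. x_state (if j = n then - c else c))"
    unfolding noise_zero_state noisy_layer_tensor_mat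
  proof (rule tensor_mat_cong)
    fix j a b
    have "(1 - lam) * ((if j = n then - 1 else 1) * (1 - lam)) = (if j = n then - c else c)"
      by (simp add: c_def power2_eq_square algebra_simps)
    then show "dep lam (conj1 (hadamard (if j = n then - 1 else 1)) (z_state (1 - lam))) a b =
        x_state (if j = n then - c else c) a b"
      by (subst conj1_hadamard_z_state) (simp_all only: dep_x_state, simp)
  qed
  have 2: "?N Oracle (tensor_mat m (\<lambda>j. x_state (if j = n then - c else c))) =
      of_real ((1 + c) / 2) \<cdot>\<^sub>m tensor_mat m (\<lambda>j. x_state ((1 - lam) * ?v j)) +
      of_real ((1 - c) / 2) \<cdot>\<^sub>m tensor_mat m (\<lambda>j. x_state ((1 - lam) * ?w j))"
    unfolding noisy_layer_def layer_mat.simps oracle_on_x_states[OF assms(1,2)]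
    by (simp only: noise_combine tensor_mat_carrier noise_tensor_mat dep_x_state)
  have 3: "?N ?H (tensor_mat m (\<lambda>j. x_state ((1 - lam) * u j))) = tensor_mat m (\<lambda>j. z_state (c * u j))" for u
    by (simp add: noisy_layer_tensor_mat conj1_hadamard_x_state dep_z_state c_def power2_eq_square mult.assoc)
  have 4: "layer_mat n (bv_fun s) m ?H \<in> carrier_mat (2 ^ m) (2 ^ m)"
    by simp
  show ?thesis
    unfolding final_state_def bv_circuit_def fold_simps(2) fold_simps(1) 1 2
      noisy_layer_combine[OF tensor_mat_carrier tensor_mat_carrier 4] 3 by simp
qed

section \<open>Measurement statistics\<close>

definition bias :: "real \<Rightarrow> bool \<Rightarrow> real" where
  "bias x b = (1 + (if b then - x else x)) / 2"

lemma bias_nonneg: "\<bar>x\<bar> \<le> 1 \<Longrightarrow> 0 \<le> bias x b"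
  by (auto simp: bias_def)

lemma sum_bias: "(\<Sum>b\<in>UNIV. bias x b) = 1"
  by (simp add: UNIV_bool bias_def field_simps)

text \<open>The diagonal of the final state is a mixture of two product distributions, whose
  marginals are their factors.\<close>

lemma marginal_circuit_mixture:
  fixes v w :: "nat \<Rightarrow> real"
  assumes final: "final_state lam n f m Ls =
      of_real a \<cdot>\<^sub>m tensor_mat m (\<lambda>j. z_state (v j)) + of_real (1 - a) \<cdot>\<^sub>m tensor_mat m (\<lambda>j. z_state (w j))"
    and a: "0 \<le> a" "a \<le> 1" and vw: "\<And>j. \<bar>v j\<bar> \<le> 1" "\<And>j. \<bar>w j\<bar> \<le> 1"
    and i: "i < m"
  shows "measure_pmf.prob (circuit_pmf lam n f m Ls) {z. z ! i = b} =
    a * bias (v i) b + (1 - a) * bias (w i) b"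
proof -
  let ?L = "{z :: bool list. length z = m}" and ?M = "circuit_pmf lam n f m Ls"
  let ?p = "\<lambda>z. if length z = m
    then a * (\<Prod>j<m. bias (v j) (z ! j)) + (1 - a) * (\<Prod>j<m. bias (w j) (z ! j)) else 0"
  have fin: "finite ?L"
    using finite_lists_length_eq[of "UNIV :: bool set" m] by simp
  have "Re (final_state lam n f m Ls $$ (basis_index z, basis_index z)) = ?p z" if "length z = m" for z
  proof -
    have "basis_index z < 2 ^ m"
      using that by (auto simp: basis_index_def less_exp_iff_bits bit_horner_sum_bit_iff)
    moreover have "bit (basis_index z) j = z ! j" if "j < m" for j
      using that \<open>length z = m\<close> by (simp add: basis_index_def bit_horner_sum_bit_iff)
    moreover have "z_state x b b = of_real (bias x b)" for x b
      by (simp add: z_state_def bias_def)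
    ultimately show ?thesis
      using that by (simp add: final flip: of_real_prod)
  qed
  then have embed: "circuit_pmf lam n f m Ls = embed_pmf ?p"
    unfolding circuit_pmf_def by (intro arg_cong[where f = embed_pmf] ext) auto
  have nonneg: "0 \<le> ?p z" for z
    using a vw by (simp add: prod_nonneg bias_nonneg)
  have "(\<Sum>z\<in>?L. \<Prod>j<m. bias (u j) (z ! j)) = 1" for u
    by (simp add: sum_prod_bool_lists[where g = "\<lambda>j. bias (u j)"] sum_bias)
  then have total: "(\<Sum>z\<in>?L. ?p z) = 1"
    by (simp add: sum.distrib flip: sum_distrib_left)
  \<comment> \<open>Total mass 1 gives \<open>embed_pmf\<close> its intended meaning.\<close>
  have "(\<integral>\<^sup>+z. ennreal (?p z) \<partial>count_space UNIV) = (\<Sum>z\<in>?L. ennreal (?p z))"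
    using fin by (rule nn_integral_count_space') auto
  also have "\<dots> = 1"
    using nonneg by (subst sum_ennreal) (simp_all only: total ennreal_1)
  finally have "(\<integral>\<^sup>+z. ennreal (?p z) \<partial>count_space UNIV) = 1" .
  with nonneg have pmf: "pmf ?M z = ?p z" for z
    unfolding embed by (rule pmf_embed_pmf)
  have marg: "(\<Sum>z\<in>?L. if z ! i = b then \<Prod>j<m. bias (u j) (z ! j) else 0) = bias (u i) b" for u
  proof -
    \<comment> \<open>Zeroing the factor at \<open>i\<close> for the other outcome encodes the event
      and keeps the summand a product.\<close>
    let ?g = "\<lambda>j x. if j = i \<and> x \<noteq> b then 0 else bias (u j) x"
    have "(\<Sum>z\<in>?L. if z ! i = b then \<Prod>j<m. bias (u j) (z ! j) else 0) =
        (\<Sum>z\<in>?L. \<Prod>j<m. ?g j (z ! j))"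
      using i by (intro sum.cong refl) (auto intro!: prod.cong prod_zero[symmetric])
    also have "\<dots> = (\<Prod>j<m. \<Sum>x\<in>UNIV. ?g j x)"
      by (rule sum_prod_bool_lists)
    also have "\<dots> = (\<Prod>j<m. if j = i then bias (u i) b else 1)"
    proof (rule prod.cong[OF refl])
      fix j
      show "(\<Sum>x\<in>UNIV. ?g j x) = (if j = i then bias (u i) b else 1)"
        by (cases "j = i"; cases b) (simp_all add: UNIV_bool sum_bias[unfolded UNIV_bool, simplified])
    qed
    also have "\<dots> = bias (u i) b"
      using i by simp
    finally show ?thesis .
  qed
  \<comment> \<open>The event also contains strings of other lengths; cutting down to the support
    leaves a finite sum.\<close>
  have "measure_pmf.prob ?M {z. z ! i = b} = measure_pmf.prob ?M ({z. z ! i = b} \<inter> set_pmf ?M)"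
    by (simp add: measure_Int_set_pmf)
  also have "{z. z ! i = b} \<inter> set_pmf ?M = ({z. z ! i = b} \<inter> ?L) \<inter> set_pmf ?M"
    by (auto simp: set_pmf_iff pmf split: if_splits)
  also have "measure_pmf.prob ?M \<dots> = (\<Sum>z\<in>{z. z ! i = b} \<inter> ?L. ?p z)"
    using fin by (simp add: measure_Int_set_pmf measure_measure_pmf_finite pmf)
  also have "\<dots> = (\<Sum>z\<in>?L. if z ! i = b then ?p z else 0)"
    using fin by (subst Int_commute, subst sum.inter_restrict) auto
  also have "\<dots> = (\<Sum>z\<in>?L. a * (if z ! i = b then \<Prod>j<m. bias (v j) (z ! j) else 0) +
      (1 - a) * (if z ! i = b then \<Prod>j<m. bias (w j) (z ! j) else 0))"
    by (rule sum.cong) auto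
  also have "\<dots> = a * bias (v i) b + (1 - a) * bias (w i) b"
    by (simp only: sum.distrib marg flip: sum_distrib_left)
  finally show ?thesis .
qed

section \<open>Majority vote\<close>

lemma prob_bind_pmf:
  "measure_pmf.prob (bind_pmf p f) S = measure_pmf.expectation p (\<lambda>x. measure_pmf.prob (f x) S)"
  unfolding measure_pmf_bind
  by (rule measure_pmf.measure_bind[where N = "count_space UNIV"])
    (auto simp: space_subprob_algebra intro: prob_space_imp_subprob_space measure_pmf.prob_space_axioms)

text \<open>\<open>v i\<close> is the number of votes for 1 minus the number of votes for 0 on bit
  \<open>i\<close>; a tie yields 0.\<close>

primrec vote_rounds :: "nat \<Rightarrow> layer list \<Rightarrow> nat \<Rightarrow> nat \<Rightarrow> (nat \<Rightarrow> int) \<Rightarrow> nisq" where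
  "vote_rounds n Ls m 0 v = Output (map (\<lambda>i. v i > 0) [0..<n])"
| "vote_rounds n Ls m (Suc N) v =
     Run m Ls (\<lambda>z. vote_rounds n Ls m N (\<lambda>i. v i + (if z ! i then 1 else - 1)))"

lemma nisq_algorithm_vote_rounds:
  "(\<And>L. L \<in> set Ls \<Longrightarrow> valid_layer n m L) \<Longrightarrow> nisq_algorithm n (vote_rounds n Ls m N v)"
  by (induction N arbitrary: v) auto

lemma queries_vote_rounds:
  "(y, q) \<in> set_pmf (exec lam n f (vote_rounds n Ls m N v)) \<Longrightarrow> q = N * count_list Ls Oracle"
  by (induction N arbitrary: v q) auto

definition vote_deficit :: "bool list \<Rightarrow> (nat \<Rightarrow> int) \<Rightarrow> nat \<Rightarrow> int" where
  "vote_deficit s v i = (if s ! i then - v i else v i)"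

text \<open>
  The potential \<open>\<Sum>\<^sub>i 2\<^bsup>wrong votes - right votes\<^esup>\<close> shrinks on average by the factor
  \<open>1/8 \<sqdot> 2 + 7/8 \<sqdot> 1/2 < 3/4\<close> in every round and is at least 1 if the final vote is wrong.
\<close>

lemma prob_vote_rounds_wrong:
  assumes "length s = n"
    and err: "\<And>i. i < n \<Longrightarrow> measure_pmf.prob (circuit_pmf lam n f m Ls) {z. z ! i = (\<not> s ! i)} \<le> 1 / 8"
  shows "measure_pmf.prob (exec lam n f (vote_rounds n Ls m N v)) {(y, q). y \<noteq> s} \<le>
    (3 / 4) ^ N * (\<Sum>i<n. 2 powi vote_deficit s v i)"
proof (induction N arbitrary: v)
  case 0
  show ?case
  proof (cases "map (\<lambda>i. v i > 0) [0..<n] = s")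
    case True
    then show ?thesis by (simp add: sum_nonneg)
  next
    case False
    then obtain i where i: "i < n" "(v i > 0) \<noteq> s ! i"
      using assms(1) by (auto simp: list_eq_iff_nth_eq)
    \<comment> \<open>A tie outputs \<open>False\<close>, so a wrong bit may have deficit exactly 0;
      its term in the potential is still at least 1.\<close>
    then have nonneg: "0 \<le> vote_deficit s v i"
      by (auto simp: vote_deficit_def)
    have "measure_pmf.prob (exec lam n f (vote_rounds n Ls m 0 v)) {(y, q). y \<noteq> s} \<le> 1"
      by (rule measure_pmf.prob_le_1)
    also have "1 \<le> (2 :: real) powi vote_deficit s v i"
      using nonneg by (simp add: one_le_power_int)
    also have "\<dots> \<le> (\<Sum>i<n. 2 powi vote_deficit s v i)"
      using i by (intro member_le_sum) auto
    finally show ?thesis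
      by (simp only: power_0 mult_1)
  qed
next
  case (Suc N)
  let ?P = "circuit_pmf lam n f m Ls"
  let ?W = "\<lambda>i. {z. z ! i = (\<not> s ! i)}"
  let ?v = "\<lambda>z i. v i + (if z ! i then 1 else - 1)"
  let ?\<phi> = "\<lambda>i. 2 powi vote_deficit s v i :: real"
  have integrable_ind: "integrable ?P (indicat_real S)" for S
    by (rule measure_pmf.integrable_const_bound[where B = 1]) auto
  \<comment> \<open>A wrong vote doubles the term of bit \<open>i\<close>, a right one halves
    it.\<close>
  have step: "2 powi vote_deficit s (?v z) i = ?\<phi> i * (1 / 2 + 3 / 2 * indicator (?W i) z)" for z i
    by (auto simp: vote_deficit_def power_int_add power_int_diff power_int_minus indicator_def field_simps)
  have "measure_pmf.prob (exec lam n f (vote_rounds n Ls m (Suc N) v)) {(y, q). y \<noteq> s} =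
      measure_pmf.expectation ?P
        (\<lambda>z. measure_pmf.prob (exec lam n f (vote_rounds n Ls m N (?v z))) {(y, q). y \<noteq> s})"
    by (simp add: prob_bind_pmf case_prod_unfold vimage_def)
  also have "\<dots> \<le> measure_pmf.expectation ?P
      (\<lambda>z. (3 / 4) ^ N * (\<Sum>i<n. ?\<phi> i * (1 / 2 + 3 / 2 * indicator (?W i) z)))"
  proof (rule integral_mono)
    show "integrable ?P (\<lambda>z. measure_pmf.prob (exec lam n f (vote_rounds n Ls m N (?v z))) {(y, q). y \<noteq> s})"
      by (rule measure_pmf.integrable_const_bound[where B = 1]) auto
    show "measure_pmf.prob (exec lam n f (vote_rounds n Ls m N (?v z))) {(y, q). y \<noteq> s} \<le>
        (3 / 4) ^ N * (\<Sum>i<n. ?\<phi> i * (1 / 2 + 3 / 2 * indicator (?W i) z))" for z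
      using Suc.IH[of "?v z"] by (simp only: step)
  qed (auto intro!: integrable_real_indicator simp: measure_pmf.emeasure_eq_measure)
  \<comment> \<open>The bits of one run may be correlated; by linearity of expectation their
    marginals suffice.\<close>
  also have "\<dots> = (3 / 4) ^ N * (\<Sum>i<n. ?\<phi> i * (1 / 2 + 3 / 2 * measure_pmf.prob ?P (?W i)))"
    by (simp add: integrable_ind)
  also have "\<dots> \<le> (3 / 4) ^ N * (\<Sum>i<n. ?\<phi> i * (3 / 4))"
    using err by (intro mult_left_mono sum_mono) fastforce+
  also have "\<dots> = (3 / 4) ^ Suc N * (\<Sum>i<n. ?\<phi> i)"
    unfolding sum_distrib_right[symmetric] by simp
  finally show ?case .
qed

section \<open>Error probability of a single run\<close>

lemma bv_circuit_error:
  assumes "length s = n" "n < m" "i < n" "0 \<le> lam" "lam < 1 / 24"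
  shows "measure_pmf.prob (circuit_pmf lam n (bv_fun s) m (bv_circuit n m)) {z. z ! i = (\<not> s ! i)} \<le> 1 / 8"
proof -
  define c where "c = (1 - lam) ^ 2"
  have c: "0 \<le> c" "c \<le> 1"
    using assms by (auto simp: c_def power_le_one)
  have cc: "c * c \<le> 1" "0 \<le> c * c"
    using c by (auto simp: mult_le_one)
  let ?v = "\<lambda>j. c * (if j = n then - 1 else if j < n \<and> s ! j then - c else c)"
  let ?w = "\<lambda>j. c * (if j = n then 1 else c)"
  have "measure_pmf.prob (circuit_pmf lam n (bv_fun s) m (bv_circuit n m)) {z. z ! i = (\<not> s ! i)} =
      (1 + c) / 2 * bias (?v i) (\<not> s ! i) + (1 - (1 + c) / 2) * bias (?w i) (\<not> s ! i)"
  proof (rule marginal_circuit_mixture)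
    have "1 - (1 + c) / 2 = (1 - c) / 2"
      by (simp add: field_simps)
    then show "final_state lam n (bv_fun s) m (bv_circuit n m) =
        of_real ((1 + c) / 2) \<cdot>\<^sub>m tensor_mat m (\<lambda>j. z_state (?v j)) +
        of_real (1 - (1 + c) / 2) \<cdot>\<^sub>m tensor_mat m (\<lambda>j. z_state (?w j))"
      using final_state_bv_circuit[OF assms(1,2), of lam] by (simp only: c_def)
  qed (use c cc assms in auto)
  \<comment> \<open>If the bit is 1, the two coordinates -c^2 and c^2 average to -c^3 and equality
    holds; if it is 0, both are c^2 and the error is (1 - c^2) / 2.\<close>
  also have "\<dots> \<le> (1 - c ^ 3) / 2"
  proof (cases "s ! i")
    case True
    then show ?thesis
      using assms by (simp add: bias_def power3_eq_cube field_simps)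
  next
    case False
    have "c * c * c \<le> c * c"
      using c cc by (simp add: mult_left_le)
    then show ?thesis
      using assms False by (simp add: bias_def power3_eq_cube field_simps)
  qed
  also have "\<dots> \<le> 1 / 8"
  proof -
    \<comment> \<open>This bounds the error by 3 \<lambda>, and the threshold 1/24 makes that less
      than 1/8.\<close>
    have "1 + real 6 * (- lam) \<le> (1 + - lam) ^ 6"
      using assms by (intro Bernoulli_inequality) auto
    moreover have "c ^ 3 = (1 - lam) ^ 6"
      by (simp add: c_def flip: power_mult)
    ultimately show ?thesis
      using assms by simp
  qed
  finally show ?thesis .
qed

section \<open>Number of rounds and the resulting algorithm\<close>

theorem theoremE1:
  shows "\<exists>C::real. C > 0 \<and>
    (\<forall>(lam::real) (n::nat) (\<delta>::real).
       0 \<le> lam \<and> lam < 1 / 24 \<and> 1 \<le> n \<and> 0 < \<delta> \<and> \<delta> < 1 \<longrightarrow>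
       (\<exists>A. nisq_algorithm n A \<and>
          (\<forall>s. length s = n \<longrightarrow>
             measure_pmf.prob (exec lam n (bv_fun s) A) {(y, q). y = s} \<ge> 1 - \<delta> \<and>
             (\<forall>(y, q) \<in> set_pmf (exec lam n (bv_fun s) A).
                real q \<le> C * (1 / (1 - 24 * lam) * ln (real n / \<delta>))))))"
\<comment> \<open>The first summand is the rate of the decay (3/4)^N; the second pays for rounding
  \<open>N\<close> up, as 1 \<le> ln x / ln 2 for x \<ge> 2.\<close>
proof (intro exI[of _ "1 / ln (4 / 3) + 1 / ln (2 :: real)"] conjI allI impI)
  show "0 < 1 / ln (4 / 3) + 1 / ln (2 :: real)"
    by (intro add_pos_pos) auto
  fix lam \<delta> :: real and n :: nat
  assume *: "0 \<le> lam \<and> lam < 1 / 24 \<and> 1 \<le> n \<and> 0 < \<delta> \<and> \<delta> < 1"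
  let ?C = "1 / ln (4 / 3) + 1 / ln (2 :: real)"
  show "\<exists>A. nisq_algorithm n A \<and>
      (\<forall>s. length s = n \<longrightarrow>
         measure_pmf.prob (exec lam n (bv_fun s) A) {(y, q). y = s} \<ge> 1 - \<delta> \<and>
         (\<forall>(y, q) \<in> set_pmf (exec lam n (bv_fun s) A).
            real q \<le> ?C * (1 / (1 - 24 * lam) * ln (real n / \<delta>))))"
  proof (cases "n = 1 \<and> \<delta> > 1 / 2")
    \<comment> \<open>Here the bound may be smaller than 1, so that no query is allowed.\<close>
    case True
    \<comment> \<open>A fair coin guesses the single bit with probability 1/2, which exceeds 1 -
      \<delta> here.\<close>
    let ?A = "Coin (\<lambda>b. Output [b])"
    have "1 - \<delta> \<le> measure_pmf.prob (exec lam n (bv_fun s) ?A) {(y, q). y = s}" if "length s = n" for s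
    proof -
      have "exec lam n (bv_fun s) ?A = map_pmf (\<lambda>b. ([b], 0)) (bernoulli_pmf (1 / 2))"
        by (simp add: map_pmf_def)
      moreover have "(\<lambda>b. ([b], 0 :: nat)) -` {(y, q). y = s} = {s ! 0}"
        using that True by (auto simp: length_Suc_conv)
      ultimately have "measure_pmf.prob (exec lam n (bv_fun s) ?A) {(y, q). y = s} = 1 / 2"
        by (cases "s ! 0") (simp_all add: measure_pmf_single)
      then show ?thesis
        using True by simp
    qed
    moreover have "0 \<le> ?C * (1 / (1 - 24 * lam) * ln (real n / \<delta>))"
      using * by (intro mult_nonneg_nonneg add_nonneg_nonneg) auto
    ultimately show ?thesis
      by (intro exI[of _ ?A]) auto
  next
    case False
    define x where "x = real n / \<delta>"
    have "2 \<le> x"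
    proof (cases "n = 1")
      case True
      with False * show ?thesis by (simp add: x_def field_simps)
    next
      case False
      with * have "2 * \<delta> \<le> 2" "(2 :: real) \<le> real n" by auto
      then have "2 * \<delta> \<le> real n" by linarith
      with * show ?thesis by (simp add: x_def field_simps)
    qed
    then have lnx: "ln 2 \<le> ln x" by simp
    \<comment> \<open>The least number of rounds that brings (3/4)^N n down to \<delta>; the
      potential starts at n because all deficits are 0.\<close>
    define N where "N = nat \<lceil>ln x / ln (4 / 3)\<rceil>"
    have N_ge: "ln x / ln (4 / 3) \<le> real N"
      unfolding N_def by (rule real_nat_ceiling_ge)
    have "real N \<le> ln x / ln (4 / 3) + 1"
      using \<open>2 \<le> x\<close> by (simp add: N_def)
    also have "\<dots> \<le> ?C * ln x"
      using lnx by (simp add: field_simps)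
    also have "\<dots> \<le> ?C * (1 / (1 - 24 * lam) * ln x)"
    proof (rule mult_left_mono)
      \<comment> \<open>The factor 1 / (1 - 24 \<lambda>) is at least 1.\<close>
      have "1 * ln x \<le> 1 / (1 - 24 * lam) * ln x"
        using * \<open>2 \<le> x\<close> by (intro mult_right_mono) (auto simp: field_simps)
      then show "ln x \<le> 1 / (1 - 24 * lam) * ln x" by simp
    qed (intro add_nonneg_nonneg; simp)
    finally have N_le: "real N \<le> ?C * (1 / (1 - 24 * lam) * ln x)" .
    have "x = exp (ln x)"
      using \<open>2 \<le> x\<close> by simp
    also have "\<dots> \<le> exp (real N * ln (4 / 3))"
      using N_ge by (simp add: field_simps)
    also have "\<dots> = (4 / 3) ^ N"
      by (simp add: exp_of_nat_mult)
    finally have "real n \<le> (4 / 3) ^ N * \<delta>"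
      using * by (simp add: x_def field_simps)
    then have small: "(3 / 4) ^ N * real n \<le> \<delta>"
      by (simp add: power_divide field_simps)
    \<comment> \<open>An even number that leaves room for \<open>n\<close> arguments and the target;
      the form \<open>2 * Suc n\<close> is kept to match
      \<open>depth_one_tensor_mat\<close>.\<close>
    define m where "m = 2 * Suc n"
    let ?Ls = "bv_circuit n m"
    let ?A = "vote_rounds n ?Ls m N (\<lambda>_. 0)"
    have "valid_layer n m L" if "L \<in> set ?Ls" for L
      using that by (auto simp: bv_circuit_def m_def simp del: mult_Suc_right
        intro!: depth_one_tensor_mat qubit_unitary_hadamard)
    then have "nisq_algorithm n ?A"
      by (rule nisq_algorithm_vote_rounds)
    moreover have deficit_0: "vote_deficit s (\<lambda>_. 0) i = 0" for s i
      by (simp add: vote_deficit_def)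
    moreover have "1 - \<delta> \<le> measure_pmf.prob (exec lam n (bv_fun s) ?A) {(y, q). y = s}" if s: "length s = n" for s
    proof -
      have "measure_pmf.prob (exec lam n (bv_fun s) ?A) {(y, q). y \<noteq> s} \<le>
          (3 / 4) ^ N * (\<Sum>i<n. 2 powi vote_deficit s (\<lambda>_. 0) i)"
        using * s by (intro prob_vote_rounds_wrong bv_circuit_error) (auto simp: m_def)
      also have "\<dots> \<le> \<delta>"
        using small by (simp add: deficit_0)
      finally have "measure_pmf.prob (exec lam n (bv_fun s) ?A) {(y, q). y \<noteq> s} \<le> \<delta>" .
      moreover have "{(y, q). y = s} = UNIV - {(y, q :: nat). y \<noteq> s}"
        by auto
      ultimately show ?thesis
        using measure_pmf.prob_compl[of "{(y, q). y \<noteq> s}" "exec lam n (bv_fun s) ?A"] by simp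
    qed
    moreover have "real q \<le> ?C * (1 / (1 - 24 * lam) * ln (real n / \<delta>))"
      if "(y, q) \<in> set_pmf (exec lam n (bv_fun s) ?A)" for s y q
    proof -
      have "count_list ?Ls Oracle = 1"
        by (simp add: bv_circuit_def)
      then have "q = N"
        using queries_vote_rounds[OF that] by simp
      with N_le show ?thesis
        by (simp add: x_def)
    qed
    ultimately show ?thesis
      by (intro exI[of _ ?A]) auto
  qed
qed

end
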